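(* Let $\{\mathcal{G}_n\}_{n\ge 2}$ be the sequence of $n$-agent mean-field games with action interval $[a,b]$, utility family $u$ and deterministic parameters $(\alpha_i)_{i\ge 1}$ described in the context, whose best response function $\mathrm{Br}$ is Lipschitz in $z$ with constant $L_z<1$ and Lipschitz in $\alpha$ with constant $L$, and such that the empirical distributions $P_n$ of $\{\alpha_i\}_{i=1}^n$ converge pointwise to a continuous distribution function $P$. Let $x^\star_{i,n}$ denote the Nash equilibrium strategy of agent $i$ in $\mathcal{G}_n$, and let $x^\star_{i,\rm ANE}=\mathrm{Br}(z^\star_{\rm AEM},\alpha_i)$ be the asymptotic Nash equilibrium strategy of agent $i$. Then, for each agent $i$, $$\lim_{n\to\infty}x^\star_{i,n}=x^\star_{i,\rm ANE}.$$
   Context: Game. Let $a\le b$ be reals, $u:[a,b]\times\mathbb{R}\times\mathbb{R}\to\mathbb{R}$ a function, and $(\alpha_i)_{i\ge1}$ a deterministic sequence of reals. For $n\ge 2$, $\mathcal{G}_n$ is the non-cooperative game with agents $1,\dots,n$ in which agent $i$ chooses an action $x_i\in[a,b]$ and maximizes the utility $u(x_i,z_{i,n},\alpha_i)$, where $z_{i,n}=\frac{1}{n-1}\sum_{j\ne i}x_j$ is the mean variable of agent $i$. Best response. $\mathrm{Br}(z,\alpha)=\arg\max_{a\le x\le b}u(x,z,\alpha)$; for all $z,\alpha\in\mathbb{R}$ the maximizer is assumed to exist and be unique, so $\mathrm{Br}:\mathbb{R}\times\mathbb{R}\to[a,b]$ is a function. Assumptions. (1) There is a constant $0<L_z<1$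 with $|\mathrm{Br}(z,\alpha)-\mathrm{Br}(z',\alpha)|\le L_z|z-z'|$ for all $z,z',\alpha\in\mathbb{R}$. (2) There is a constant $L>0$ with $|\mathrm{Br}(z,\alpha)-\mathrm{Br}(z,\alpha')|\le L|\alpha-\alpha'|$ for all $z,\alpha,\alpha'\in\mathbb{R}$. (3) With $P_n(\alpha)=\frac1n\sum_{i=1}^n \mathbf{1}\{\alpha_i\le\alpha\}$, there is a continuous (probability) distribution function $P$ such that $\lim_{n\to\infty}P_n(\alpha)=P(\alpha)$ for all $\alpha\in\mathbb{R}$. Nash equilibrium. A Nash equilibrium of $\mathcal{G}_n$ is $(x^\star_{1,n},\dots,x^\star_{n,n})\in[a,b]^n$ with $x^\star_{i,n}=\mathrm{Br}(z^\star_{i,n},\alpha_i)$ for all $i$, where $z^\star_{i,n}=\frac{1}{n-1}\sum_{j\ne i}x^\star_{j,n}$. Under the assumptions it exists and is unique. Asymptotic equilibrium mean. $z^\star_{\rm AEM}$ is the (unique) solution $z$ of $z=\int_{-\infty}^{\infty}\mathrm{Br}(z,\alpha)\,dP(\alpha)$. *)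

theory Defs
  imports "HOL-Probability.Probability"
begin

text \<open>Agents are numbered from 1, so a parameter sequence \<open>\<alpha>\<close> is used only at positive indices,
  and an action profile of the \<open>n\<close>-agent game is an element of \<open>{1..n} \<rightarrow>\<^sub>E {a..b}\<close>.
  A utility \<open>u x z c\<close> takes the own action, the mean variable and the parameter; it
  matters only for \<open>x \<in> {a..b}\<close>.\<close>

definition unique_maximizers ::
    "real \<Rightarrow> real \<Rightarrow> (real \<Rightarrow> real \<Rightarrow> real \<Rightarrow> real) \<Rightarrow> bool" where
  "unique_maximizers a b u \<longleftrightarrow>
     (\<forall>z c. \<exists>!x. is_arg_max (\<lambda>x. u x z c) (\<lambda>x. x \<in> {a..b}) x)"

definition Br ::
    "real \<Rightarrow> real \<Rightarrow> (real \<Rightarrow> real \<Rightarrow> real \<Rightarrow> real) \<Rightarrow> real \<Rightarrow> real \<Rightarrow> real" where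
  "Br a b u z c = arg_max (\<lambda>x. u x z c) (\<lambda>x. x \<in> {a..b})"

definition mean_variable :: "nat \<Rightarrow> (nat \<Rightarrow> real) \<Rightarrow> nat \<Rightarrow> real" where
  "mean_variable n x i = (\<Sum>j\<in>{1..n} - {i}. x j) / (real n - 1)"

definition is_nash_equilibrium ::
    "real \<Rightarrow> real \<Rightarrow> (real \<Rightarrow> real \<Rightarrow> real \<Rightarrow> real) \<Rightarrow> (nat \<Rightarrow> real) \<Rightarrow> nat \<Rightarrow> (nat \<Rightarrow> real) \<Rightarrow> bool" where
  "is_nash_equilibrium a b u \<alpha> n x \<longleftrightarrow>
     x \<in> {1..n} \<rightarrow>\<^sub>E {a..b} \<and>
     (\<forall>i\<in>{1..n}. x i = Br a b u (mean_variable n x i) (\<alpha> i))"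

definition nash_equilibrium ::
    "real \<Rightarrow> real \<Rightarrow> (real \<Rightarrow> real \<Rightarrow> real \<Rightarrow> real) \<Rightarrow> (nat \<Rightarrow> real) \<Rightarrow> nat \<Rightarrow> nat \<Rightarrow> real" where
  "nash_equilibrium a b u \<alpha> n = (THE x. is_nash_equilibrium a b u \<alpha> n x)"

definition empirical_df :: "(nat \<Rightarrow> real) \<Rightarrow> nat \<Rightarrow> real \<Rightarrow> real" where
  "empirical_df \<alpha> n t = (\<Sum>i=1..n. of_bool (\<alpha> i \<le> t)) / real n"

definition distribution_function :: "(real \<Rightarrow> real) \<Rightarrow> bool" where
  "distribution_function P \<longleftrightarrow>
     mono P \<and> (\<forall>t. continuous (at_right t) P) \<and>
     (P \<longlongrightarrow> 0) at_bot \<and> (P \<longlongrightarrow> 1) at_top"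

text \<open>The integral \<open>dP\<close> is the Lebesgue--Stieltjes integral.\<close>

definition z_AEM ::
    "real \<Rightarrow> real \<Rightarrow> (real \<Rightarrow> real \<Rightarrow> real \<Rightarrow> real) \<Rightarrow> (real \<Rightarrow> real) \<Rightarrow> real" where
  "z_AEM a b u P = (THE z. z = (LINT c|interval_measure P. Br a b u z c))"

definition x_ANE ::
    "real \<Rightarrow> real \<Rightarrow> (real \<Rightarrow> real \<Rightarrow> real \<Rightarrow> real) \<Rightarrow> (nat \<Rightarrow> real) \<Rightarrow> (real \<Rightarrow> real) \<Rightarrow> nat \<Rightarrow> real" where
  "x_ANE a b u \<alpha> P i = Br a b u (z_AEM a b u P) (\<alpha> i)"

end

theory Submission imports Defs begin

text \<open>
  The Nash equilibrium and the asymptotic equilibrium mean are both fixed points of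
  \<open>L_z\<close>-contractions, so both exist and are unique, and what has to be shown is that the
  two contractions approach each other.  Best responding to a profile is a contraction in the
  supremum norm, because the mean variables depend on the profile with Lipschitz constant 1
  (\<open>nash_equilibrium_ex1\<close>); the map \<open>z \<mapsto> \<integral> Br z c dP(c)\<close> is a contraction on the line
  (\<open>mean_fixed_point_ex1\<close>).

  Write \<open>m\<close> for the average of all \<open>n\<close> equilibrium actions, \<open>z\<^sub>i\<close> for the mean variable of agent
  \<open>i\<close>, and \<open>z\<close> for the asymptotic equilibrium mean.  Leaving one agent out of the average moves
  it by at most \<open>(b - a) / (n - 1)\<close>, so \<open>m\<close> is, up to an error of \<open>L_z (b - a) / (n - 1)\<close> plus
  \<open>L_z \<bar>m - z\<bar>\<close>, the average of the best responses \<open>Br z \<alpha>\<^sub>i\<close>.  That average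
  is the integral of the bounded continuous function \<open>Br z\<close> with respect to the empirical
  distribution of the parameters, which converges weakly to the law with distribution function
  \<open>P\<close>; its limit is therefore \<open>\<integral> Br z c dP(c) = z\<close> (\<open>tendsto_empirical_average\<close>).  Since
  \<open>L_z < 1\<close>, the term \<open>L_z \<bar>m - z\<bar>\<close> can be absorbed on the left, and \<open>m\<close> tends to \<open>z\<close>.
  Then so does each mean variable \<open>z\<^sub>i\<close>, and continuity of the best response gives the claim.
\<close>

section \<open>Existence and uniqueness of the Nash equilibrium\<close>

text \<open>Banach's fixed point theorem for profiles with finitely many agents and the supremum
  distance.  The profiles are embedded in the complete space of bounded continuous functions
  on the index type with the discrete metric; a profile is bounded because it takes a single
  value outside \<open>I\<close>.\<close>

lemma sup_contraction_fixed_point_ex1: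
  fixes T :: "('i \<Rightarrow> real) \<Rightarrow> 'i \<Rightarrow> real"
  assumes fin: "finite I" and q: "0 \<le> q" "q < 1"
    and contr: "\<And>x y d i. (\<And>j. j \<in> I \<Longrightarrow> \<bar>x j - y j\<bar> \<le> d) \<Longrightarrow> i \<in> I \<Longrightarrow>
      \<bar>T x i - T y i\<bar> \<le> q * d"
  shows "\<exists>!x. x \<in> extensional I \<and> (\<forall>i\<in>I. x i = T x i)"
proof -
  define emb :: "('i \<Rightarrow> real) \<Rightarrow> 'i discrete \<Rightarrow>\<^sub>C real"
    where "emb x = Bcontfun (\<lambda>k. x (of_discrete k))" for x
  define prj :: "('i discrete \<Rightarrow>\<^sub>C real) \<Rightarrow> 'i \<Rightarrow> real"
    where "prj f = (\<lambda>i. apply_bcontfun f (discrete i))" for f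
  define G where "G f = emb (restrict (T (prj f)) I)" for f
  have apply_emb: "apply_bcontfun (emb x) k = x (of_discrete k)" if "x \<in> extensional I" for x k
  proof -
    have "range (\<lambda>k. x (of_discrete k)) \<subseteq> insert undefined (x ` I)"
      using that by (auto simp: extensional_def)
    then have "bounded (range (\<lambda>k. x (of_discrete k)))"
      using fin by (meson finite_imageI finite_insert finite_imp_bounded finite_subset)
    moreover have "continuous_on UNIV (\<lambda>k. x (of_discrete k))"
      by (simp add: continuous_on_open_vimage open_discrete)
    ultimately show ?thesis
      by (simp add: emb_def bcontfun_def Bcontfun_inverse)
  qed
  have prj_emb: "prj (emb x) = x" if "x \<in> extensional I" for x
    using that by (simp add: prj_def apply_emb discrete_inverse)
  have prj_dist: "\<bar>prj f j - prj g j\<bar> \<le> dist f g" for f g j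
    using dist_bounded[of f "discrete j" g] by (simp add: prj_def dist_real_def)
  have "dist (G f) (G g) \<le> q * dist f g" for f g
  proof (rule dist_bound)
    fix k
    show "dist (apply_bcontfun (G f) k) (apply_bcontfun (G g) k) \<le> q * dist f g"
    proof (cases "of_discrete k \<in> I")
      case True
      then show ?thesis
        using contr[OF prj_dist True] by (simp add: G_def apply_emb dist_real_def)
    qed (simp add: G_def apply_emb q)
  qed
  then have "\<exists>!f. G f = f"
    using q by (intro banach_fix_type[where c = q]) auto
  then obtain f where f: "G f = f" and uniq: "\<And>g. G g = g \<Longrightarrow> g = f"
    by metis
  have prj_f: "prj f = restrict (T (prj f)) I"
    using prj_emb[of "restrict (T (prj f)) I"] f by (simp add: G_def)
  show ?thesis
  proof (rule ex1I[of _ "prj f"])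
    show "prj f \<in> extensional I \<and> (\<forall>i\<in>I. prj f i = T (prj f) i)"
      using prj_f by (metis restrict_apply' restrict_extensional)
  next
    fix x assume x: "x \<in> extensional I \<and> (\<forall>i\<in>I. x i = T x i)"
    then have "restrict (T x) I = x"
      by (auto simp: extensional_def restrict_def)
    then have "G (emb x) = emb x"
      using x by (simp add: G_def prj_emb)
    then show "x = prj f"
      using uniq x prj_emb by metis
  qed
qed

lemma mean_variable_diff_le:
  assumes "2 \<le> n" "i \<in> {1..n}" and d: "\<And>j. j \<in> {1..n} \<Longrightarrow> \<bar>x j - y j\<bar> \<le> d"
  shows "\<bar>mean_variable n x i - mean_variable n y i\<bar> \<le> d"
proof -
  have n1: "real (card ({1..n} - {i})) = real n - 1"
    using assms by simp
  have "\<bar>\<Sum>j\<in>{1..n} - {i}. x j - y j\<bar> \<le> (\<Sum>j\<in>{1..n} - {i}. \<bar>x j - y j\<bar>)"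
    by (rule sum_abs)
  also have "\<dots> \<le> real (card ({1..n} - {i})) * d"
    by (rule sum_bounded_above) (use d in auto)
  finally have "\<bar>\<Sum>j\<in>{1..n} - {i}. x j - y j\<bar> \<le> (real n - 1) * d"
    by (simp only: n1)
  moreover have "mean_variable n x i - mean_variable n y i
      = (\<Sum>j\<in>{1..n} - {i}. x j - y j) / (real n - 1)"
    by (simp add: mean_variable_def sum_subtractf diff_divide_distrib)
  ultimately show ?thesis
    using assms(1) by (simp add: pos_divide_le_eq mult.commute)
qed

lemma Br_in_action_interval:
  assumes "unique_maximizers a b u"
  shows "Br a b u z c \<in> {a..b}"
proof -
  have "is_arg_max (\<lambda>x. u x z c) (\<lambda>x. x \<in> {a..b}) (Br a b u z c)"
    using assms unfolding unique_maximizers_def Br_def arg_max_def by (metis someI_ex)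
  then show ?thesis
    by (simp add: is_arg_max_def)
qed

lemma nash_equilibrium_ex1:
  assumes um: "unique_maximizers a b u" and q: "0 \<le> q" "q < 1"
    and lip: "\<And>z z' c. \<bar>Br a b u z c - Br a b u z' c\<bar> \<le> q * \<bar>z - z'\<bar>"
    and n: "2 \<le> n"
  shows "\<exists>!x. is_nash_equilibrium a b u \<alpha> n x"
proof -
  let ?T = "\<lambda>x i. Br a b u (mean_variable n x i) (\<alpha> i)"
  have "\<bar>?T x i - ?T y i\<bar> \<le> q * d"
    if d: "\<And>j. j \<in> {1..n} \<Longrightarrow> \<bar>x j - y j\<bar> \<le> d" and i: "i \<in> {1..n}" for x y d i
  proof -
    have "\<bar>mean_variable n x i - mean_variable n y i\<bar> \<le> d"
      using n i d by (rule mean_variable_diff_le)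
    then have "q * \<bar>mean_variable n x i - mean_variable n y i\<bar> \<le> q * d"
      using q(1) by (rule mult_left_mono)
    with lip show ?thesis
      by (rule order_trans)
  qed
  then have "\<exists>!x. x \<in> extensional {1..n} \<and> (\<forall>i\<in>{1..n}. x i = ?T x i)"
    using q by (intro sup_contraction_fixed_point_ex1[where q = q]) auto
  moreover have "is_nash_equilibrium a b u \<alpha> n x \<longleftrightarrow>
      x \<in> extensional {1..n} \<and> (\<forall>i\<in>{1..n}. x i = ?T x i)" for x
  proof -
    have "x i \<in> {a..b}" if "x i = ?T x i" for i
      by (subst that) (rule Br_in_action_interval[OF um])
    then show ?thesis
      unfolding is_nash_equilibrium_def PiE_def Pi_def by blast
  qed
  ultimately show ?thesis
    by simp
qed

section \<open>The asymptotic equilibrium mean\<close>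

lemma mean_fixed_point_ex1:
  fixes B :: "real \<Rightarrow> real \<Rightarrow> real"
  assumes "prob_space M" and q: "0 \<le> q" "q < 1"
    and int: "\<And>z. integrable M (B z)"
    and lip: "\<And>z z' c. \<bar>B z c - B z' c\<bar> \<le> q * \<bar>z - z'\<bar>"
  shows "\<exists>!z. z = (LINT c|M. B z c)"
proof -
  interpret prob_space M by fact
  have "dist (LINT c|M. B z c) (LINT c|M. B z' c) \<le> q * dist z z'" for z z'
  proof -
    have "\<bar>LINT c|M. B z c - B z' c\<bar> \<le> (LINT c|M. \<bar>B z c - B z' c\<bar>)"
      by (rule integral_abs_bound)
    also have "\<dots> \<le> (LINT c|M. q * \<bar>z - z'\<bar>)"
      using int lip by (intro integral_mono) auto
    finally show ?thesis
      using int by (simp add: dist_real_def prob_space)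
  qed
  then have "\<exists>!z. (LINT c|M. B z c) = z"
    using q by (intro banach_fix_type[where c = q]) auto
  then show ?thesis
    by metis
qed

section \<open>Weak convergence of the empirical distributions\<close>

text \<open>The empirical distribution is the law of \<open>\<alpha>\<close> at a uniformly chosen agent, so an average
  over agents is an integral and pointwise convergence of \<open>empirical_df\<close> is weak convergence.\<close>

lemma tendsto_empirical_average:
  fixes f :: "real \<Rightarrow> real"
  assumes P: "distribution_function P"
    and conv: "\<And>t. (\<lambda>n. empirical_df \<alpha> n t) \<longlonglongrightarrow> P t"
    and cont: "\<And>c. isCont f c" and bdd: "\<And>c. \<bar>f c\<bar> \<le> K"
  shows "(\<lambda>n. (\<Sum>i=1..n. f (\<alpha> i)) / real n) \<longlonglongrightarrow> (LINT c|interval_measure P. f c)"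
proof -
  define \<mu> where "\<mu> n = distr (measure_pmf (pmf_of_set {1..n})) borel \<alpha>" for n
  have [measurable]: "f \<in> borel_measurable borel"
    using cont by (simp add: borel_measurable_continuous_onI continuous_at_imp_continuous_on)
  have P': "mono P" "\<And>t. continuous (at_right t) P" "(P \<longlongrightarrow> 0) at_bot" "(P \<longlongrightarrow> 1) at_top"
    using P by (auto simp: distribution_function_def)
  \<comment> \<open>For \<open>n = 0\<close> the uniform law on the empty set is unspecified, but still a probability
    law, so every \<open>\<mu> n\<close> is a distribution and only the identities below need \<open>n \<ge> 1\<close>.\<close>
  have cdf_\<mu>: "cdf (\<mu> n) t = empirical_df \<alpha> n t" if "n \<ge> 1" for n t
  proof -
    have "cdf (\<mu> n) t = measure (measure_pmf (pmf_of_set {1..n})) {i. \<alpha> i \<le> t}"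
      by (simp add: cdf_def \<mu>_def measure_distr vimage_def)
    also have "\<dots> = real (card ({1..n} \<inter> {i. \<alpha> i \<le> t})) / real n"
      using that by (subst measure_pmf_of_set) auto
    finally show ?thesis
      by (simp add: empirical_df_def of_bool_def sum.If_cases)
  qed
  have "weak_conv_m \<mu> (interval_measure P)"
    unfolding weak_conv_m_def weak_conv_def
  proof (intro allI impI)
    fix t
    have "\<forall>\<^sub>F n in sequentially. empirical_df \<alpha> n t = cdf (\<mu> n) t"
      using eventually_ge_at_top[of 1] by eventually_elim (simp add: cdf_\<mu>)
    then have "(\<lambda>n. cdf (\<mu> n) t) \<longlonglongrightarrow> P t"
      by (rule Lim_transform_eventually[OF conv])
    then show "(\<lambda>n. cdf (\<mu> n) t) \<longlonglongrightarrow> cdf (interval_measure P) t"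
      using P' by (simp add: cdf_interval_measure monoD)
  qed
  moreover have "real_distribution (\<mu> n)" for n
    unfolding \<mu>_def by (rule prob_space.real_distribution_distr) (auto intro: prob_space_measure_pmf)
  moreover have "real_distribution (interval_measure P)"
    using P' by (intro real_distribution_interval_measure) (auto dest: monoD)
  ultimately have "(\<lambda>n. integral\<^sup>L (\<mu> n) f) \<longlonglongrightarrow> (LINT c|interval_measure P. f c)"
    using cont bdd by (intro weak_conv_imp_integral_bdd_continuous_conv[where B = K]) auto
  then show ?thesis
  proof (rule Lim_transform_eventually)
    show "\<forall>\<^sub>F n in sequentially. integral\<^sup>L (\<mu> n) f = (\<Sum>i=1..n. f (\<alpha> i)) / real n"
      using eventually_ge_at_top[of 1]
      by eventually_elim (simp add: \<mu>_def integral_distr integral_pmf_of_set)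
  qed
qed

section \<open>Convergence of the equilibria\<close>

text \<open>Leaving one agent out of the average of all actions changes it by the order of \<open>1 / n\<close>.\<close>

lemma mean_variable_near_average:
  assumes n: "2 \<le> n" and i: "i \<in> {1..n}" and x: "\<And>j. j \<in> {1..n} \<Longrightarrow> x j \<in> {a..b}"
  shows "\<bar>mean_variable n x i - (\<Sum>j=1..n. x j) / real n\<bar> \<le> (b - a) / (real n - 1)"
proof -
  define m where "m = (\<Sum>j=1..n. x j) / real n"
  have m: "real n * m = (\<Sum>j=1..n. x j)"
    using n by (simp add: m_def)
  have "real n * a \<le> (\<Sum>j=1..n. x j)" "(\<Sum>j=1..n. x j) \<le> real n * b"
    using sum_bounded_below[of "{1..n}" a x] sum_bounded_above[of "{1..n}" x b] x by auto
  then have "a \<le> m" "m \<le> b"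
    using n by (simp_all add: m_def pos_le_divide_eq pos_divide_le_eq mult.commute)
  then have "\<bar>m - x i\<bar> \<le> b - a"
    using x[OF i] by (auto simp: abs_le_iff)
  moreover have "mean_variable n x i - m = (m - x i) / (real n - 1)"
  proof -
    have "mean_variable n x i = (real n * m - x i) / (real n - 1)"
      using i by (simp add: mean_variable_def m sum_diff1)
    then show ?thesis
      using n by (simp add: field_simps)
  qed
  ultimately have "\<bar>mean_variable n x i - m\<bar> \<le> (b - a) / (real n - 1)"
    using n by (simp add: divide_right_mono)
  then show ?thesis
    by (simp only: m_def)
qed

text \<open>Both sides of the equilibrium condition are averaged over the agents, and the best responses
  to the mean variables are replaced by those to a fixed \<open>z\<close>; the part of the resulting
  error proportional to \<open>\<bar>m - z\<bar>\<close> is moved to the left, which leaves the factor \<open>1 - q\<close>.\<close>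

lemma nash_average_near:
  assumes ne: "is_nash_equilibrium a b u \<alpha> n x" and n: "2 \<le> n" and q: "0 \<le> q"
    and lip: "\<And>z z' c. \<bar>Br a b u z c - Br a b u z' c\<bar> \<le> q * \<bar>z - z'\<bar>"
  shows "(1 - q) * \<bar>(\<Sum>i=1..n. x i) / real n - z\<bar> \<le>
    q * ((b - a) / (real n - 1)) + \<bar>(\<Sum>i=1..n. Br a b u z (\<alpha> i)) / real n - z\<bar>"
proof -
  define m where "m = (\<Sum>i=1..n. x i) / real n"
  define F where "F = (\<Sum>i=1..n. Br a b u z (\<alpha> i)) / real n"
  define e where "e = (b - a) / (real n - 1)"
  have x: "\<And>j. j \<in> {1..n} \<Longrightarrow> x j \<in> {a..b}"
    and eq: "\<And>j. j \<in> {1..n} \<Longrightarrow> x j = Br a b u (mean_variable n x j) (\<alpha> j)"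
    using ne unfolding is_nash_equilibrium_def by (blast dest: PiE_mem)+
  have term_le: "\<bar>x i - Br a b u z (\<alpha> i)\<bar> \<le> q * (\<bar>m - z\<bar> + e)" if i: "i \<in> {1..n}" for i
  proof -
    have "\<bar>mean_variable n x i - m\<bar> \<le> e"
      unfolding m_def e_def using n i x by (rule mean_variable_near_average)
    then have "\<bar>mean_variable n x i - z\<bar> \<le> \<bar>m - z\<bar> + e"
      by linarith
    then have "q * \<bar>mean_variable n x i - z\<bar> \<le> q * (\<bar>m - z\<bar> + e)"
      using q by (rule mult_left_mono)
    then show ?thesis
      using lip[of "mean_variable n x i" "\<alpha> i" z] eq[OF i] by simp
  qed
  have "\<bar>\<Sum>i=1..n. x i - Br a b u z (\<alpha> i)\<bar> \<le> (\<Sum>i=1..n. \<bar>x i - Br a b u z (\<alpha> i)\<bar>)"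
    by (rule sum_abs)
  also have "\<dots> \<le> real n * (q * (\<bar>m - z\<bar> + e))"
    using sum_bounded_above[of "{1..n}" _ "q * (\<bar>m - z\<bar> + e)"] term_le by auto
  finally have "\<bar>m - F\<bar> \<le> q * (\<bar>m - z\<bar> + e)"
    using n by (simp add: m_def F_def sum_subtractf flip: diff_divide_distrib)
      (simp add: pos_divide_le_eq mult.commute)
  then have "(1 - q) * \<bar>m - z\<bar> \<le> q * e + \<bar>F - z\<bar>"
    by (simp add: algebra_simps)
  then show ?thesis
    by (simp only: m_def F_def e_def)
qed

theorem corollary1:
  fixes a b L_z L :: real
    and u :: "real \<Rightarrow> real \<Rightarrow> real \<Rightarrow> real"
    and \<alpha> :: "nat \<Rightarrow> real"
    and P :: "real \<Rightarrow> real"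
    and i :: nat
  assumes "a \<le> b"
    and "unique_maximizers a b u"
    and "0 < L_z" and "L_z < 1"
    and "\<And>z z' c. \<bar>Br a b u z c - Br a b u z' c\<bar> \<le> L_z * \<bar>z - z'\<bar>"
    and "0 < L"
    and "\<And>z c c'. \<bar>Br a b u z c - Br a b u z c'\<bar> \<le> L * \<bar>c - c'\<bar>"
    and "distribution_function P"
    and "continuous_on UNIV P"
    and "\<And>t. (\<lambda>n. empirical_df \<alpha> n t) \<longlonglongrightarrow> P t"
    and "i \<ge> 1"
  shows "(\<lambda>n. nash_equilibrium a b u \<alpha> n i) \<longlonglongrightarrow> x_ANE a b u \<alpha> P i"
proof -
  note um = assms(2) and q = less_imp_le[OF assms(3)] assms(4) and lip = assms(5)
  define M where "M = interval_measure P"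
  define z where "z = z_AEM a b u P"
  define x where "x = nash_equilibrium a b u \<alpha>"
  define m where "m n = (\<Sum>j=1..n. x n j) / real n" for n
  define e where "e n = (b - a) / (real n - 1)" for n :: nat

  have "real_distribution M"
    using assms(8) unfolding M_def distribution_function_def
    by (intro real_distribution_interval_measure) (auto dest: monoD)
  then interpret M: real_distribution M .

  have Br_cont: "isCont (Br a b u y) c" for y c
  proof -
    have "L-lipschitz_on UNIV (Br a b u y)"
      using assms(6,7) by (intro lipschitz_onI) (auto simp: dist_real_def)
    then show ?thesis
      by (metis lipschitz_on_continuous_on continuous_on_eq_continuous_at open_UNIV UNIV_I)
  qed
  have Br_bdd: "\<bar>Br a b u y c\<bar> \<le> max \<bar>a\<bar> \<bar>b\<bar>" for y c
    using Br_in_action_interval[OF um, of y c] by auto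
  have "integrable M (Br a b u y)" for y
  proof (rule M.integrable_const_bound)
    have "Br a b u y \<in> borel_measurable borel"
      using Br_cont by (simp add: borel_measurable_continuous_onI continuous_at_imp_continuous_on)
    then show "Br a b u y \<in> borel_measurable M"
      by (subst measurable_cong_sets[OF M.events_eq_borel refl])
  qed (use Br_bdd in auto)
  then have "\<exists>!y. y = (LINT c|M. Br a b u y c)"
    using q lip by (intro mean_fixed_point_ex1[where q = L_z] M.prob_space_axioms) auto
  then have z: "z = (LINT c|M. Br a b u z c)"
    unfolding z_def z_AEM_def M_def by (rule theI')
  have avg: "(\<lambda>n. (\<Sum>j=1..n. Br a b u z (\<alpha> j)) / real n) \<longlonglongrightarrow> z"
    using tendsto_empirical_average[OF assms(8,10) Br_cont Br_bdd, of z] z by (simp add: M_def)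

  have ne: "is_nash_equilibrium a b u \<alpha> n (x n)" if "2 \<le> n" for n
    unfolding x_def nash_equilibrium_def using nash_equilibrium_ex1[OF um q lip that] by (rule theI')
  have e: "e \<longlonglongrightarrow> 0"
    unfolding e_def by real_asymp

  have "(\<lambda>n. m n - z) \<longlonglongrightarrow> 0"
  proof (rule Lim_null_comparison)
    show "\<forall>\<^sub>F n in sequentially. norm (m n - z) \<le>
        (L_z * e n + \<bar>(\<Sum>j=1..n. Br a b u z (\<alpha> j)) / real n - z\<bar>) / (1 - L_z)"
      using eventually_ge_at_top[of 2]
    proof eventually_elim
      case (elim n)
      show ?case
        using nash_average_near[OF ne[OF elim] elim q(1) lip, of z] q
        by (simp add: m_def e_def pos_le_divide_eq mult.commute)
    qed
    have "(\<lambda>n. (L_z * e n + \<bar>(\<Sum>j=1..n. Br a b u z (\<alpha> j)) / real n - z\<bar>) / (1 - L_z))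
        \<longlonglongrightarrow> (L_z * 0 + \<bar>z - z\<bar>) / (1 - L_z)"
      using q by (intro tendsto_intros e avg) auto
    then show "(\<lambda>n. (L_z * e n + \<bar>(\<Sum>j=1..n. Br a b u z (\<alpha> j)) / real n - z\<bar>) / (1 - L_z))
        \<longlonglongrightarrow> 0"
      by simp
  qed
  then have bound: "(\<lambda>n. L_z * (\<bar>m n - z\<bar> + e n)) \<longlonglongrightarrow> 0"
    using tendsto_mult[OF tendsto_const[of L_z] tendsto_add[OF tendsto_rabs e]] by fastforce

  have "(\<lambda>n. x n i - Br a b u z (\<alpha> i)) \<longlonglongrightarrow> 0"
  proof (rule Lim_null_comparison[OF _ bound])
    show "\<forall>\<^sub>F n in sequentially. norm (x n i - Br a b u z (\<alpha> i)) \<le> L_z * (\<bar>m n - z\<bar> + e n)"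
      using eventually_ge_at_top[of 2] eventually_ge_at_top[of i]
    proof eventually_elim
      case (elim n)
      then have i: "i \<in> {1..n}"
        using assms(11) by simp
      have x: "\<And>j. j \<in> {1..n} \<Longrightarrow> x n j \<in> {a..b}"
        and eq: "x n i = Br a b u (mean_variable n (x n) i) (\<alpha> i)"
        using ne[OF elim(1)] i unfolding is_nash_equilibrium_def by (blast dest: PiE_mem)+
      have "\<bar>mean_variable n (x n) i - m n\<bar> \<le> e n"
        unfolding m_def e_def using elim(1) i x by (rule mean_variable_near_average)
      then have "\<bar>mean_variable n (x n) i - z\<bar> \<le> \<bar>m n - z\<bar> + e n"
        by linarith
      then have "L_z * \<bar>mean_variable n (x n) i - z\<bar> \<le> L_z * (\<bar>m n - z\<bar> + e n)"
        using q(1) by (rule mult_left_mono)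
      then show ?case
        using lip[of "mean_variable n (x n) i" "\<alpha> i" z] eq by simp
    qed
  qed
  then show ?thesis
    unfolding x_ANE_def x_def z_def by (simp add: LIM_zero_iff)
qed

end
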